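(* Let $n\ge 1$ and $\lambda>0$. For every $t>0$ and every $E\subset\mathbb{R}^n$, $$\mu_\lambda(tE)=t^n\,\mu_{\lambda/t}(E),$$ where $tE=\{tx: x\in E\}$.
   Context: Work in $\mathbb{R}^n$ with the Euclidean metric; $\operatorname{diam}$ is Euclidean diameter. For $\lambda>0$ the mixed gauge is $h_\lambda(r)=r^n+\lambda r^{n-1}$ for $r>0$, with $h_\lambda(0)=0$. For $E\subset\mathbb{R}^n$ define $$\mu_\lambda(E):=\inf\Big\{\sum_i \big((\operatorname{diam} U_i)^n+\lambda(\operatorname{diam} U_i)^{n-1}\big) : E\subset\bigcup_i U_i\Big\},$$ where the infimum is over all at most countable families $(U_i)$ of balls (or, alternatively, of cubes; the choice of family is fixed once and for all, and the claim is made for either choice) of positive diameter, the empty family being allowed for $E=\emptyset$, so $\mu_\lambda(\emptyset)=0$. There is no restriction on the size of the diameters. *)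

theory Defs
  imports "HOL-Analysis.Analysis"
begin

definition open_balls :: "(real ^ 'n) set set" where
  "open_balls = {ball x r | x r. r > 0}"

definition closed_balls :: "(real ^ 'n) set set" where
  "closed_balls = {cball x r | x r. r > 0}"

definition open_cubes :: "(real ^ 'n) set set" where
  "open_cubes = {box a (\<chi> i. a $ i + s) | a s. s > 0}"

definition closed_cubes :: "(real ^ 'n) set set" where
  "closed_cubes = {cbox a (\<chi> i. a $ i + s) | a s. s > 0}"

(* All congruent copies of the members of F; translations need not be mentioned when F is
   translation invariant, as the families of axis-parallel cubes are. *)
definition any_orientation :: "(real ^ 'n) set set \<Rightarrow> (real ^ 'n) set set" where
  "any_orientation F = {f ` Q | f Q. orthogonal_transformation f \<and> Q \<in> F}"

(* The admissible choices of covering family: balls, axis-parallel cubes, or cubes of arbitrary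
   orientation, each either open or closed. All members have positive diameter. *)
definition covering_families :: "(real ^ 'n) set set set" where
  "covering_families =
     {open_balls, closed_balls,
      open_cubes, closed_cubes,
      any_orientation open_cubes, any_orientation closed_cubes}"

(* Coverings are families (U i) indexed by an arbitrary I :: nat set, so finite, countably infinite
   and empty families are all included. The values are extended nonnegative reals, so the infinite
   sum and the infimum always exist. *)
definition mu :: "(real ^ 'n) set set \<Rightarrow> real \<Rightarrow> (real ^ 'n) set \<Rightarrow> ennreal" where
  "mu F lam E =
     Inf {(\<Sum>\<^sub>\<infinity>i\<in>I. ennreal (diameter (U i) ^ CARD('n) + lam * diameter (U i) ^ (CARD('n) - 1)))
          | (I :: nat set) U. (\<forall>i\<in>I. U i \<in> F) \<and> E \<subseteq> (\<Union>i\<in>I. U i)}"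

end

theory Submission
  imports Defs
begin

text \<open>Scaling by \<open>t\<close> maps admissible coverings of \<open>E\<close> to admissible coverings of \<open>tE\<close>, and since
  \<open>h\<^sub>\<lambda>(t r) = t\<^sup>n h\<^bsub>\<lambda>/t\<^esub>(r)\<close> it multiplies their cost by \<open>t\<^sup>n\<close>. This yields one inequality; the
  other is the same inequality for the inverse scaling.\<close>

lemma diameter_scaleR_le:
  fixes S :: "'a :: real_normed_vector set"
  assumes "bounded S" "t \<ge> 0"
  shows "diameter ((*\<^sub>R) t ` S) \<le> t * diameter S"
proof (rule diameter_le)
  show "(*\<^sub>R) t ` S \<noteq> {} \<or> 0 \<le> t * diameter S"
    using assms by (simp add: diameter_ge_0)
next
  fix x y assume "x \<in> (*\<^sub>R) t ` S" "y \<in> (*\<^sub>R) t ` S"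
  then obtain u v where uv: "x = t *\<^sub>R u" "y = t *\<^sub>R v" "u \<in> S" "v \<in> S" by blast
  have "norm (x - y) = t * dist u v"
    using assms(2) uv by (simp add: dist_norm flip: scaleR_diff_right)
  also have "\<dots> \<le> t * diameter S"
    using assms uv by (intro mult_left_mono diameter_bounded_bound)
  finally show "norm (x - y) \<le> t * diameter S" .
qed

lemma diameter_scaleR:
  fixes S :: "'a :: real_normed_vector set"
  assumes "bounded S" "t > 0"
  shows "diameter ((*\<^sub>R) t ` S) = t * diameter S"
proof (rule antisym)
  show "diameter ((*\<^sub>R) t ` S) \<le> t * diameter S"
    using assms by (intro diameter_scaleR_le) auto
  have "diameter ((*\<^sub>R) (1/t) ` (*\<^sub>R) t ` S) \<le> (1/t) * diameter ((*\<^sub>R) t ` S)"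
    using assms by (intro diameter_scaleR_le bounded_scaling) auto
  moreover have "(*\<^sub>R) (1/t) ` (*\<^sub>R) t ` S = S"
    using assms by (simp add: image_image)
  ultimately show "t * diameter S \<le> diameter ((*\<^sub>R) t ` S)"
    using assms by (simp add: field_simps)
qed

text \<open>In \<open>ennreal\<close> an infinite sum is the supremum of its finite partial sums,
  and multiplication by a constant commutes with suprema, so divergent sums and infinite
  \<open>c\<close> are covered too.\<close>

lemma infsum_cmult_right_ennreal:
  fixes f :: "'a \<Rightarrow> ennreal"
  shows "(\<Sum>\<^sub>\<infinity>i\<in>A. c * f i) = c * (\<Sum>\<^sub>\<infinity>i\<in>A. f i)"
  by (simp add: nonneg_infsum_complete SUP_mult_left_ennreal flip: sum_distrib_left)

lemma scaleR_image_box_cart: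
  fixes a b :: "real ^ 'n"
  assumes "t > 0"
  shows "(*\<^sub>R) t ` box a b = box (t *\<^sub>R a) (t *\<^sub>R b)"
proof -
  have "x \<in> (*\<^sub>R) t ` box a b" if "x \<in> box (t *\<^sub>R a) (t *\<^sub>R b)" for x
    using that assms
    by (intro image_eqI[of _ _ "(1/t) *\<^sub>R x"]) (auto simp: mem_box_cart field_simps)
  then show ?thesis
    using assms by (auto simp: mem_box_cart)
qed

lemma scaleR_image_cbox_cart:
  fixes a b :: "real ^ 'n"
  assumes "t > 0"
  shows "(*\<^sub>R) t ` cbox a b = cbox (t *\<^sub>R a) (t *\<^sub>R b)"
proof -
  have "x \<in> (*\<^sub>R) t ` cbox a b" if "x \<in> cbox (t *\<^sub>R a) (t *\<^sub>R b)" for x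
    using that assms
    by (intro image_eqI[of _ _ "(1/t) *\<^sub>R x"]) (auto simp: mem_box_cart field_simps)
  then show ?thesis
    using assms by (auto simp: mem_box_cart)
qed

text \<open>Gathers what the scaling argument asks of a covering family, so that all six choices are
  treated at once: closure under scaling keeps coverings admissible, and boundedness lets diameters
  scale by \<open>t\<close>.\<close>

definition scale_closed_bounded :: "(real ^ 'n) set set \<Rightarrow> bool" where
  "scale_closed_bounded F \<longleftrightarrow>
     (\<forall>Q\<in>F. bounded Q \<and> (\<forall>t>0. (*\<^sub>R) t ` Q \<in> F))"

lemma scale_closed_bounded_open_balls: "scale_closed_bounded open_balls"
  unfolding scale_closed_bounded_def open_balls_def
proof (intro ballI conjI allI impI)
  fix Q :: "(real ^ 'n) set" and t :: real
  assume "Q \<in> {ball x r | x r. r > 0}" "t > 0"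
  then obtain x r where Q: "Q = ball x r" "r > 0" by blast
  have "(*\<^sub>R) t ` Q = ball (t *\<^sub>R x) (t * r)" "t * r > 0"
    using Q \<open>t > 0\<close> ball_scale[of t x r] by auto
  then show "(*\<^sub>R) t ` Q \<in> {ball x r | x r. r > 0}" by blast
qed auto

lemma scale_closed_bounded_closed_balls: "scale_closed_bounded closed_balls"
  unfolding scale_closed_bounded_def closed_balls_def
proof (intro ballI conjI allI impI)
  fix Q :: "(real ^ 'n) set" and t :: real
  assume "Q \<in> {cball x r | x r. r > 0}" "t > 0"
  then obtain x r where Q: "Q = cball x r" "r > 0" by blast
  have "(*\<^sub>R) t ` Q = cball (t *\<^sub>R x) (t * r)" "t * r > 0"
    using Q \<open>t > 0\<close> cball_scale[of t x r] by auto
  then show "(*\<^sub>R) t ` Q \<in> {cball x r | x r. r > 0}" by blast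
qed auto

text \<open>Brings the scaled far corner back to the shape in the definition of cubes, which
  exhibits the scaled cube as one with corner \<open>t *\<^sub>R a\<close> and side
  \<open>t * s\<close>.\<close>

lemma scaleR_cube_corner:
  fixes a :: "real ^ 'n"
  shows "t *\<^sub>R (\<chi> i. a $ i + s) = (\<chi> i. (t *\<^sub>R a) $ i + t * s)"
  by (simp add: vec_eq_iff distrib_left)

lemma scale_closed_bounded_open_cubes: "scale_closed_bounded open_cubes"
  unfolding scale_closed_bounded_def open_cubes_def
proof (intro ballI conjI allI impI)
  fix Q :: "(real ^ 'n) set" and t :: real
  assume "Q \<in> {box a (\<chi> i. a $ i + s) | a s. s > 0}" "t > 0"
  then obtain a s where Q: "Q = box a (\<chi> i. a $ i + s)" "s > 0" by blast
  have "(*\<^sub>R) t ` Q = box (t *\<^sub>R a) (\<chi> i. (t *\<^sub>R a) $ i + t * s)" "t * s > 0"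
    using Q \<open>t > 0\<close> by (simp_all only: scaleR_image_box_cart scaleR_cube_corner mult_pos_pos)
  then show "(*\<^sub>R) t ` Q \<in> {box a (\<chi> i. a $ i + s) | a s. s > 0}" by blast
qed (auto simp: bounded_box)

lemma scale_closed_bounded_closed_cubes: "scale_closed_bounded closed_cubes"
  unfolding scale_closed_bounded_def closed_cubes_def
proof (intro ballI conjI allI impI)
  fix Q :: "(real ^ 'n) set" and t :: real
  assume "Q \<in> {cbox a (\<chi> i. a $ i + s) | a s. s > 0}" "t > 0"
  then obtain a s where Q: "Q = cbox a (\<chi> i. a $ i + s)" "s > 0" by blast
  have "(*\<^sub>R) t ` Q = cbox (t *\<^sub>R a) (\<chi> i. (t *\<^sub>R a) $ i + t * s)" "t * s > 0"
    using Q \<open>t > 0\<close> by (simp_all only: scaleR_image_cbox_cart scaleR_cube_corner mult_pos_pos)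
  then show "(*\<^sub>R) t ` Q \<in> {cbox a (\<chi> i. a $ i + s) | a s. s > 0}" by blast
qed (auto simp: bounded_cbox)

text \<open>Orthogonal maps are linear, so they preserve boundedness and commute with scaling: the
  scaled copy of \<open>Q\<close> is the copy of the scaled \<open>Q\<close> under the same
  map.\<close>

lemma scale_closed_bounded_any_orientation:
  assumes "scale_closed_bounded F"
  shows "scale_closed_bounded (any_orientation F)"
  unfolding scale_closed_bounded_def
proof (intro ballI conjI allI impI)
  fix P assume "P \<in> any_orientation F"
  then obtain f Q where fQ: "P = f ` Q" "orthogonal_transformation f" "Q \<in> F"
    unfolding any_orientation_def by blast
  then have lin: "linear f" by (simp add: orthogonal_transformation_linear)
  show "bounded P"
    using assms fQ lin
    by (auto simp: scale_closed_bounded_def linear_conv_bounded_linear intro: bounded_linear_image)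
  fix t :: real assume "t > 0"
  have "(*\<^sub>R) t ` P = f ` (*\<^sub>R) t ` Q"
    using fQ(1) lin by (simp add: image_image linear_scale)
  moreover have "(*\<^sub>R) t ` Q \<in> F"
    using assms fQ(3) \<open>t > 0\<close> by (simp add: scale_closed_bounded_def)
  ultimately show "(*\<^sub>R) t ` P \<in> any_orientation F"
    using fQ(2) unfolding any_orientation_def by blast
qed

lemma covering_families_scale_closed_bounded:
  "F \<in> covering_families \<Longrightarrow> scale_closed_bounded F"
  unfolding covering_families_def
  by (auto intro: scale_closed_bounded_open_balls scale_closed_bounded_closed_balls
      scale_closed_bounded_open_cubes scale_closed_bounded_closed_cubes
      scale_closed_bounded_any_orientation)

text \<open>The lower-order term yields \<open>t ^ (n - 1)\<close>, which is
  \<open>t ^ n / t\<close> because \<open>n > 0\<close>; the missing factor turns \<open>lam\<close>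
  into \<open>lam / t\<close>.\<close>

lemma gauge_scale:
  fixes t d lam :: real
  assumes "t > 0" "n > 0"
  shows "(t * d) ^ n + lam * (t * d) ^ (n - 1) = t ^ n * (d ^ n + lam / t * d ^ (n - 1))"
  using assms by (cases n) (simp_all add: field_simps power_mult_distrib)

text \<open>The two constants are finite with product 1, so by associativity they cancel even when
  \<open>x\<close> is infinite.\<close>

lemma ennreal_mult_inverse_power_cancel:
  assumes "t > 0"
  shows "ennreal (t ^ n) * (ennreal ((1 / t) ^ n) * x) = x"
  using assms by (simp add: power_divide flip: mult.assoc ennreal_mult)

text \<open>Each covering of \<open>E\<close> is scaled member by member, and its cost is compared
  with the infimum for the scaled set. The factor \<open>t\<close> and the parameter
  \<open>lam\<close> are kept general so that the bound can also be used for the inverse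
  scaling.\<close>

lemma mu_scale_le:
  fixes E :: "(real ^ 'n) set"
  assumes F: "scale_closed_bounded F" and t: "t > 0"
  shows "mu F lam ((*\<^sub>R) t ` E) \<le> ennreal (t ^ CARD('n)) * mu F (lam / t) E"
proof -
  let ?h = "\<lambda>l S :: (real ^ 'n) set.
    ennreal (diameter S ^ CARD('n) + l * diameter S ^ (CARD('n) - 1))"
  have cover: "mu F lam ((*\<^sub>R) t ` E) \<le> ennreal (t ^ CARD('n)) * (\<Sum>\<^sub>\<infinity>i\<in>I. ?h (lam / t) (U i))"
    if U: "\<forall>i\<in>I. U i \<in> F" "E \<subseteq> (\<Union>i\<in>I. U i)" for I :: "nat set" and U
  proof -
    have "mu F lam ((*\<^sub>R) t ` E) \<le> (\<Sum>\<^sub>\<infinity>i\<in>I. ?h lam ((*\<^sub>R) t ` U i))"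
      unfolding mu_def
    proof (rule Inf_lower, rule CollectI, intro exI conjI)
      show "\<forall>i\<in>I. (*\<^sub>R) t ` U i \<in> F"
        using F t U(1) by (simp add: scale_closed_bounded_def)
      show "(*\<^sub>R) t ` E \<subseteq> (\<Union>i\<in>I. (*\<^sub>R) t ` U i)"
        using U(2) by blast
    qed (rule refl)
    also have "\<dots> = (\<Sum>\<^sub>\<infinity>i\<in>I. ennreal (t ^ CARD('n)) * ?h (lam / t) (U i))"
    proof (rule infsum_cong)
      fix i assume "i \<in> I"
      then have "bounded (U i)"
        using F U(1) by (simp add: scale_closed_bounded_def)
      then show "?h lam ((*\<^sub>R) t ` U i) = ennreal (t ^ CARD('n)) * ?h (lam / t) (U i)"
        \<comment> \<open>\<open>ennreal_mult'\<close> asks only that the first factor,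
          \<open>t ^ CARD('n)\<close>, be nonnegative.\<close>
        using t by (simp only: diameter_scaleR gauge_scale zero_less_card_finite
            ennreal_mult' zero_le_power less_imp_le)
    qed
    finally show ?thesis by (simp only: infsum_cmult_right_ennreal)
  qed
  \<comment> \<open>The constant is moved to the left so that the right side is a bare infimum; it
    then suffices to bound the cost of each covering from below.\<close>
  have "ennreal ((1 / t) ^ CARD('n)) * mu F lam ((*\<^sub>R) t ` E) \<le> mu F (lam / t) E"
    unfolding mu_def[of F "lam / t"]
  proof (rule Inf_greatest)
    fix c assume "c \<in> {(\<Sum>\<^sub>\<infinity>i\<in>I. ?h (lam / t) (U i)) | (I :: nat set) U.
      (\<forall>i\<in>I. U i \<in> F) \<and> E \<subseteq> (\<Union>i\<in>I. U i)}"
    then have "mu F lam ((*\<^sub>R) t ` E) \<le> ennreal (t ^ CARD('n)) * c"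
      using cover by blast
    then have "ennreal ((1 / t) ^ CARD('n)) * mu F lam ((*\<^sub>R) t ` E) \<le>
      ennreal ((1 / t) ^ CARD('n)) * (ennreal (t ^ CARD('n)) * c)"
      by (rule mult_left_mono) simp
    also have "\<dots> = c"
      \<comment> \<open>Cancellation is taken at \<open>1 / t\<close>, whose inverse is
        \<open>t\<close>, since the constants occur in the opposite order here.\<close>
      using ennreal_mult_inverse_power_cancel[of "1 / t" "CARD('n)" c] t by simp
    finally show "ennreal ((1 / t) ^ CARD('n)) * mu F lam ((*\<^sub>R) t ` E) \<le> c" .
  qed
  then have "ennreal (t ^ CARD('n)) * (ennreal ((1 / t) ^ CARD('n)) * mu F lam ((*\<^sub>R) t ` E)) \<le>
    ennreal (t ^ CARD('n)) * mu F (lam / t) E"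
    by (rule mult_left_mono) simp
  then show ?thesis
    by (simp only: ennreal_mult_inverse_power_cancel[OF t])
qed

theorem theorem3p3:
  fixes E :: "(real ^ 'n) set" and F :: "(real ^ 'n) set set" and lam t :: real
  assumes "F \<in> covering_families" and "lam > 0" and "t > 0"
  shows "mu F lam ((\<lambda>x. t *\<^sub>R x) ` E) = ennreal (t ^ CARD('n)) * mu F (lam / t) E"
proof (rule antisym)
  have F: "scale_closed_bounded F"
    using assms(1) by (rule covering_families_scale_closed_bounded)
  show "mu F lam ((\<lambda>x. t *\<^sub>R x) ` E) \<le> ennreal (t ^ CARD('n)) * mu F (lam / t) E"
    using mu_scale_le[OF F assms(3)] .
  \<comment> \<open>Inverse scaling: the set is now \<open>tE\<close>, the factor
    \<open>1 / t\<close> and the parameter \<open>lam / t\<close>, chosen so that dividing it by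
    \<open>1 / t\<close> restores \<open>lam\<close>.\<close>
  have "mu F (lam / t) ((*\<^sub>R) (1 / t) ` (*\<^sub>R) t ` E) \<le>
    ennreal ((1 / t) ^ CARD('n)) * mu F (lam / t / (1 / t)) ((*\<^sub>R) t ` E)"
    using assms(3) by (intro mu_scale_le[OF F]) simp
  moreover have "(*\<^sub>R) (1 / t) ` (*\<^sub>R) t ` E = E" "lam / t / (1 / t) = lam"
    using assms(3) by (simp_all add: image_image)
  ultimately have "mu F (lam / t) E \<le> ennreal ((1 / t) ^ CARD('n)) * mu F lam ((*\<^sub>R) t ` E)"
    by simp
  then have "ennreal (t ^ CARD('n)) * mu F (lam / t) E \<le>
    ennreal (t ^ CARD('n)) * (ennreal ((1 / t) ^ CARD('n)) * mu F lam ((*\<^sub>R) t ` E))"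
    by (rule mult_left_mono) simp
  then show "ennreal (t ^ CARD('n)) * mu F (lam / t) E \<le> mu F lam ((\<lambda>x. t *\<^sub>R x) ` E)"
    by (simp only: ennreal_mult_inverse_power_cancel[OF assms(3)])
qed

end
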